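(* Consider the principal problem (described in the context) with data $\hat A,\hat B,\hat G,\mathcal M$, the Bellman operators $\mathcal B_u,\mathcal B$, and the value iteration $V_0(z,r)=\max_{H\in\mathcal M}r(H)$, $V_{k+1}=\mathcal B V_k$. Then: 1. $\mathcal B$ is monotone: $V'\ge V$ implies $\mathcal B V'\ge \mathcal B V$. 2. The value iteration is nondecreasing: $V_{k+1}\ge V_k$. 3. The value iteration converges if, and only if, it is bounded. 4. The value $\inf_\mu\sup_{H\in\mathcal M,d,N}\hat J^N_\mu(z_0,H,d)$ of the principal problem is bounded for all $z_0\in\mathbb R^{n_z}$ if, and only if, the value iteration converges. If the value iteration converges to a limit $V_\star$, then: 5. The value of the principal problem with initial state $z_0$ is equal to $V_\star(z_0,0)$. 6. $V_\star$ is a fixed point of $\mathcal B$, not necessarily unique. 7. $V_\star$ is the minimal fixed point of $\mathcal B$ greater than $V_0$ (i.e. among the fixed points that are $\ge V_0$). 8. The control law $\eta_\star$, where $\eta_\star(z,r)$ is defined as the minimizer over $u$ of $\mathcal B_uV_\star(z,r)$, achieves $\mathcal B_{\eta_\star(z,r)}V_\star(z,r)=\mathcal B V_\star(z,r)$, and the policy $\mu_t(z_0,\dots,z_t,u_0,\dots,u_{t-1},d_0,\dots,d_{t-1})=\eta_\star(z_t,r_t)$ is optimal for the principal problem.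
   Context: Notation: $\mathbb S^n$ is the space of real symmetric $n\times n$ matrices. For a symmetric block matrix $H$, $\sigma_H(x_1,\dots,x_m)=\sum_{i,j}x_i^{\mathsf T}H^{ij}x_j$. If $H$ has blocks indexed by $z,u,d$ and $H^{dd}$ is invertible, $H/H^{dd}$ is the Schur complement, a symmetric matrix with blocks indexed by $z,u$: its $(a,b)$ block is $H^{ab}-H^{ad}(H^{dd})^{-1}H^{db}$, $a,b\in\{z,u\}$; $[H/H^{dd}]^{uu}$ is its $(u,u)$ block. $\mathbb R^{\mathcal M}$ is the set of all functions from $\mathcal M$ to $\mathbb R$. Principal problem. Data: $\hat A\in\mathbb R^{n_z\times n_z}$, $\hat B\in\mathbb R^{n_z\times n_u}$, $\hat G\in\mathbb R^{n_z\times n_d}$, $z_0\in\mathbb R^{n_z}$, and a compact set $\mathcal M\subset\mathbb S^{n_z+n_u+n_d}$ each of whose members $H$ (with blocks indexed by $z,u,d$) satisfies $H^{dd}\prec 0$, $H/H^{dd}\succeq 0$, $[H/H^{dd}]^{uu}\succ 0$. A policy $\mu=(\mu_t)_{t\ge 0}$ and a disturbance sequence $d$ generate $z_{t+1}=\hat Az_t+\hat Bu_t+\hat Gd_t$, $u_t=\mu_t(z_0,\dots,z_t,u_0,\dots,u_{t-1},d_0,\dots,d_{t-1})$. For a horizon $N\ge 0$ let $\hat J^N_\mu(z_0,H,d)=\sum_{t=0}^{N-1}\sigma_H(z_t,u_t,d_t)$. The value of the problem is $\inf_\mu\sup_{H\in\mathcal M,\,d,\,N}\hat J^N_\mu(z_0,H,d)$;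 a policy is optimal if it attains the infimum. Information state: $r_t:\mathcal M\to\mathbb R$, $r_t(H)=\sum_{s=0}^{t-1}\sigma_H(z_s,u_s,d_s)$, so $r_0=0$ and $r_{t+1}=f(r_t,z_t,u_t,d_t)$ with $f(r,z,u,d)(H)=r(H)+\sigma_H(z,u,d)$. Bellman operators: for a function $V:\mathbb R^{n_z}\times\mathbb R^{\mathcal M}\to\mathbb R$, $\mathcal B_uV(z,r)=\max_{d}V(\hat Az+\hat Bu+\hat Gd,\,f(r,z,u,d))$ and $\mathcal BV(z,r)=\min_u\mathcal B_uV(z,r)$. Inequalities between functions, and convergence and boundedness of sequences of functions, are interpreted pointwise.
   Formalization: Max and min in V_0, B_u, B are read as sup and inf in [-∞,∞]; "bounded" and "converges" require finite values only at (z,r) with V_0(z,r) finite, since for infinite M max r(H) is undefined if r is unbounded above. M is nonempty; "the minimizer" means any minimizer. *)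

theory Defs
  imports "HOL-Analysis.Analysis"
begin

definition posdef :: "real^'n^'n \<Rightarrow> bool" where
  "posdef Q \<longleftrightarrow> transpose Q = Q \<and> (\<forall>x. x \<noteq> 0 \<longrightarrow> x \<bullet> (Q *v x) > 0)"

definition possemidef :: "real^'n^'n \<Rightarrow> bool" where
  "possemidef Q \<longleftrightarrow> transpose Q = Q \<and> (\<forall>x. x \<bullet> (Q *v x) \<ge> 0)"

definition negdef :: "real^'n^'n \<Rightarrow> bool" where
  "negdef Q \<longleftrightarrow> posdef (- Q)"

definition block :: "('a \<Rightarrow> 'm) \<Rightarrow> ('b \<Rightarrow> 'n) \<Rightarrow> real^'n^'m \<Rightarrow> real^'b^'a" where
  "block f g Q = (\<chi> i j. Q $ f i $ g j)"

text \<open>The index type is \<open>('z + 'u) + 'd\<close>, so that the Schur complement of the \<open>d\<close>-block is a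
  matrix over the index type \<open>'z + 'u\<close>.\<close>

type_synonym ('z, 'u, 'd) hmat = "real^(('z + 'u) + 'd)^(('z + 'u) + 'd)"

abbreviation ix_z :: "'z \<Rightarrow> ('z + 'u) + 'd" where "ix_z i \<equiv> Inl (Inl i)"
abbreviation ix_u :: "'u \<Rightarrow> ('z + 'u) + 'd" where "ix_u i \<equiv> Inl (Inr i)"
abbreviation ix_d :: "'d \<Rightarrow> ('z + 'u) + 'd" where "ix_d i \<equiv> Inr i"

definition sigma ::
  "('z::finite, 'u::finite, 'd::finite) hmat \<Rightarrow> real^'z \<Rightarrow> real^'u \<Rightarrow> real^'d \<Rightarrow> real" where
  "sigma H z u d =
     z \<bullet> (block ix_z ix_z H *v z) + z \<bullet> (block ix_z ix_u H *v u) + z \<bullet> (block ix_z ix_d H *v d)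
   + u \<bullet> (block ix_u ix_z H *v z) + u \<bullet> (block ix_u ix_u H *v u) + u \<bullet> (block ix_u ix_d H *v d)
   + d \<bullet> (block ix_d ix_z H *v z) + d \<bullet> (block ix_d ix_u H *v u) + d \<bullet> (block ix_d ix_d H *v d)"

definition schur_d ::
  "('z::finite, 'u::finite, 'd::finite) hmat \<Rightarrow> real^('z + 'u)^('z + 'u)" where
  "schur_d H = block Inl Inl H
     - block Inl Inr H ** matrix_inv (block Inr Inr H) ** block Inr Inl H"

text \<open>Nonemptiness of the model set is implicit in taking maxima over it.\<close>

definition model_set :: "('z::finite, 'u::finite, 'd::finite) hmat set \<Rightarrow> bool" where
  "model_set M \<longleftrightarrow> compact M \<and> M \<noteq> {} \<and>
     (\<forall>H\<in>M. transpose H = H \<and> negdef (block ix_d ix_d H) \<and>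
            possemidef (schur_d H) \<and> posdef (block Inr Inr (schur_d H)))"

text \<open>\<open>\<mu> t [z\<^sub>0,\<dots>,z\<^sub>t] [u\<^sub>0,\<dots>,u\<^sub>t\<^sub>-\<^sub>1] [d\<^sub>0,\<dots>,d\<^sub>t\<^sub>-\<^sub>1]\<close> is the input at time \<open>t\<close>.\<close>

type_synonym ('z, 'u, 'd) policy =
  "nat \<Rightarrow> (real^'z) list \<Rightarrow> (real^'u) list \<Rightarrow> (real^'d) list \<Rightarrow> real^'u"

primrec history ::
  "real^'z^'z \<Rightarrow> real^'u^'z \<Rightarrow> real^'d^'z \<Rightarrow> ('z, 'u, 'd) policy \<Rightarrow> real^'z \<Rightarrow>
   (nat \<Rightarrow> real^'d) \<Rightarrow> nat \<Rightarrow> (real^'z) list \<times> (real^'u) list" where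
  "history A B G \<mu> z0 d 0 = ([z0], [])"
| "history A B G \<mu> z0 d (Suc t) =
     (case history A B G \<mu> z0 d t of (zs, us) \<Rightarrow>
        let u = \<mu> t zs us (map d [0..<t])
        in (zs @ [A *v last zs + B *v u + G *v d t], us @ [u]))"

definition state ::
  "real^'z^'z \<Rightarrow> real^'u^'z \<Rightarrow> real^'d^'z \<Rightarrow> ('z, 'u, 'd) policy \<Rightarrow> real^'z \<Rightarrow>
   (nat \<Rightarrow> real^'d) \<Rightarrow> nat \<Rightarrow> real^'z" where
  "state A B G \<mu> z0 d t = last (fst (history A B G \<mu> z0 d t))"

definition input ::
  "real^'z^'z \<Rightarrow> real^'u^'z \<Rightarrow> real^'d^'z \<Rightarrow> ('z, 'u, 'd) policy \<Rightarrow> real^'z \<Rightarrow>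
   (nat \<Rightarrow> real^'d) \<Rightarrow> nat \<Rightarrow> real^'u" where
  "input A B G \<mu> z0 d t =
     (case history A B G \<mu> z0 d t of (zs, us) \<Rightarrow> \<mu> t zs us (map d [0..<t]))"

lemma history_eq:
  "history A B G \<mu> z0 d t =
     (map (state A B G \<mu> z0 d) [0..<Suc t], map (input A B G \<mu> z0 d) [0..<t])"
proof (induction t)
  case 0
  show ?case by (simp add: state_def)
next
  case (Suc t)
  have "history A B G \<mu> z0 d (Suc t) =
      (fst (history A B G \<mu> z0 d t) @ [state A B G \<mu> z0 d (Suc t)],
       snd (history A B G \<mu> z0 d t) @ [input A B G \<mu> z0 d t])"
    by (simp add: state_def input_def Let_def split: prod.split)
  then show ?case
    by (simp only: Suc.IH) simp
qed

lemma closed_loop: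
  shows "state A B G \<mu> z0 d 0 = z0"
    and "state A B G \<mu> z0 d (Suc t) =
           A *v state A B G \<mu> z0 d t + B *v input A B G \<mu> z0 d t + G *v d t"
    and "input A B G \<mu> z0 d t =
           \<mu> t (map (state A B G \<mu> z0 d) [0..<Suc t]) (map (input A B G \<mu> z0 d) [0..<t])
             (map d [0..<t])"
proof -
  show "state A B G \<mu> z0 d 0 = z0"
    by (simp add: state_def)
  show "state A B G \<mu> z0 d (Suc t) =
           A *v state A B G \<mu> z0 d t + B *v input A B G \<mu> z0 d t + G *v d t"
    by (simp add: state_def input_def Let_def split: prod.split)
  show "input A B G \<mu> z0 d t =
           \<mu> t (map (state A B G \<mu> z0 d) [0..<Suc t]) (map (input A B G \<mu> z0 d) [0..<t])
             (map d [0..<t])"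
    unfolding input_def[of A B G \<mu> z0 d t] history_eq by simp
qed

definition cost ::
  "real^'z^'z \<Rightarrow> real^'u^'z \<Rightarrow> real^'d^'z \<Rightarrow> ('z, 'u, 'd) policy \<Rightarrow> nat \<Rightarrow> real^'z \<Rightarrow>
   ('z, 'u, 'd) hmat \<Rightarrow> (nat \<Rightarrow> real^'d) \<Rightarrow> real" where
  "cost A B G \<mu> N z0 H d =
     (\<Sum>t<N. sigma H (state A B G \<mu> z0 d t) (input A B G \<mu> z0 d t) (d t))"

definition worst_case_cost ::
  "real^'z^'z \<Rightarrow> real^'u^'z \<Rightarrow> real^'d^'z \<Rightarrow> ('z, 'u, 'd) hmat set \<Rightarrow>
   ('z, 'u, 'd) policy \<Rightarrow> real^'z \<Rightarrow> ereal" where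
  "worst_case_cost A B G M \<mu> z0 =
     (SUP (H, d, N) \<in> M \<times> UNIV \<times> UNIV. ereal (cost A B G \<mu> N z0 H d))"

definition problem_value ::
  "real^'z^'z \<Rightarrow> real^'u^'z \<Rightarrow> real^'d^'z \<Rightarrow> ('z, 'u, 'd) hmat set \<Rightarrow> real^'z \<Rightarrow> ereal" where
  "problem_value A B G M z0 = (INF \<mu>. worst_case_cost A B G M \<mu> z0)"

definition optimal_policy ::
  "real^'z^'z \<Rightarrow> real^'u^'z \<Rightarrow> real^'d^'z \<Rightarrow> ('z, 'u, 'd) hmat set \<Rightarrow> real^'z \<Rightarrow>
   ('z, 'u, 'd) policy \<Rightarrow> bool" where
  "optimal_policy A B G M z0 \<mu> \<longleftrightarrow> worst_case_cost A B G M \<mu> z0 = problem_value A B G M z0"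

text \<open>The space of all functions from \<open>M\<close> to the reals is rendered by the extensional functions, so
  that an information state carries no data outside \<open>M\<close>.\<close>

type_synonym ('z, 'u, 'd) info = "('z, 'u, 'd) hmat \<Rightarrow> real"

definition infos :: "('z::finite, 'u::finite, 'd::finite) hmat set \<Rightarrow> ('z, 'u, 'd) info set" where
  "infos M = M \<rightarrow>\<^sub>E UNIV"

definition info_zero ::
  "('z::finite, 'u::finite, 'd::finite) hmat set \<Rightarrow> ('z, 'u, 'd) info" where
  "info_zero M = (\<lambda>H\<in>M. 0)"

definition info_step ::
  "('z::finite, 'u::finite, 'd::finite) hmat set \<Rightarrow> ('z, 'u, 'd) info \<Rightarrow>
   real^'z \<Rightarrow> real^'u \<Rightarrow> real^'d \<Rightarrow> ('z, 'u, 'd) info" where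
  "info_step M r z u d = (\<lambda>H\<in>M. r H + sigma H z u d)"

text \<open>Value functions are extended-real valued: a maximum over all disturbances may be infinite, and
  so may \<open>V\<^sub>0\<close> at an information state that is unbounded above. Maxima and minima are rendered by
  suprema and infima.\<close>

type_synonym ('z, 'u, 'd) valfun = "real^'z \<Rightarrow> ('z, 'u, 'd) info \<Rightarrow> ereal"

definition val_le ::
  "('z::finite, 'u::finite, 'd::finite) hmat set \<Rightarrow> ('z, 'u, 'd) valfun \<Rightarrow> ('z, 'u, 'd) valfun
   \<Rightarrow> bool" where
  "val_le M V W \<longleftrightarrow> (\<forall>z. \<forall>r\<in>infos M. V z r \<le> W z r)"

definition bellman_u ::
  "real^'z^'z \<Rightarrow> real^'u^'z \<Rightarrow> real^'d^'z \<Rightarrow> ('z, 'u, 'd) hmat set \<Rightarrow> real^'u \<Rightarrow>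
   ('z, 'u, 'd) valfun \<Rightarrow> ('z, 'u, 'd) valfun" where
  "bellman_u A B G M u V z r = (SUP d. V (A *v z + B *v u + G *v d) (info_step M r z u d))"

definition bellman ::
  "real^'z^'z \<Rightarrow> real^'u^'z \<Rightarrow> real^'d^'z \<Rightarrow> ('z, 'u, 'd) hmat set \<Rightarrow>
   ('z, 'u, 'd) valfun \<Rightarrow> ('z, 'u, 'd) valfun" where
  "bellman A B G M V z r = (INF u. bellman_u A B G M u V z r)"

definition fixed_point ::
  "real^'z^'z \<Rightarrow> real^'u^'z \<Rightarrow> real^'d^'z \<Rightarrow> ('z, 'u, 'd) hmat set \<Rightarrow>
   ('z, 'u, 'd) valfun \<Rightarrow> bool" where
  "fixed_point A B G M V \<longleftrightarrow> (\<forall>z. \<forall>r\<in>infos M. bellman A B G M V z r = V z r)"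

definition V_init ::
  "('z::finite, 'u::finite, 'd::finite) hmat set \<Rightarrow> ('z, 'u, 'd) valfun" where
  "V_init M z r = (SUP H\<in>M. ereal (r H))"

primrec value_iteration ::
  "real^'z^'z \<Rightarrow> real^'u^'z \<Rightarrow> real^'d^'z \<Rightarrow> ('z, 'u, 'd) hmat set \<Rightarrow>
   nat \<Rightarrow> ('z, 'u, 'd) valfun" where
  "value_iteration A B G M 0 = V_init M"
| "value_iteration A B G M (Suc k) = bellman A B G M (value_iteration A B G M k)"

text \<open>If \<open>r\<close> is unbounded above on \<open>M\<close>, then every iterate is infinite at \<open>(z, r)\<close>, whatever the
  data. Finiteness is therefore required exactly where \<open>V\<^sub>0\<close> is finite, that is, where \<open>r\<close> is bounded
  above; if \<open>M\<close> is finite, that is everywhere.\<close>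

definition finite_valued ::
  "('z::finite, 'u::finite, 'd::finite) hmat set \<Rightarrow> ('z, 'u, 'd) valfun \<Rightarrow> bool" where
  "finite_valued M V \<longleftrightarrow> (\<forall>z. \<forall>r\<in>infos M. V_init M z r < \<infinity> \<longrightarrow> \<bar>V z r\<bar> \<noteq> \<infinity>)"

definition value_iteration_bounded ::
  "real^'z^'z \<Rightarrow> real^'u^'z \<Rightarrow> real^'d^'z \<Rightarrow> ('z, 'u, 'd) hmat set \<Rightarrow> bool" where
  "value_iteration_bounded A B G M \<longleftrightarrow>
     (\<forall>z. \<forall>r\<in>infos M. V_init M z r < \<infinity> \<longrightarrow>
        (\<exists>c::real. \<forall>k. \<bar>value_iteration A B G M k z r\<bar> \<le> ereal c))"

definition value_iteration_limit ::
  "real^'z^'z \<Rightarrow> real^'u^'z \<Rightarrow> real^'d^'z \<Rightarrow> ('z, 'u, 'd) hmat set \<Rightarrow>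
   ('z, 'u, 'd) valfun \<Rightarrow> bool" where
  "value_iteration_limit A B G M V \<longleftrightarrow> finite_valued M V \<and>
     (\<forall>z. \<forall>r\<in>infos M. (\<lambda>k. value_iteration A B G M k z r) \<longlonglongrightarrow> V z r)"

definition value_iteration_converges ::
  "real^'z^'z \<Rightarrow> real^'u^'z \<Rightarrow> real^'d^'z \<Rightarrow> ('z, 'u, 'd) hmat set \<Rightarrow> bool" where
  "value_iteration_converges A B G M \<longleftrightarrow> (\<exists>V. value_iteration_limit A B G M V)"

definition minimizing_law ::
  "real^'z^'z \<Rightarrow> real^'u^'z \<Rightarrow> real^'d^'z \<Rightarrow> ('z, 'u, 'd) hmat set \<Rightarrow>
   ('z, 'u, 'd) valfun \<Rightarrow> (real^'z \<Rightarrow> ('z, 'u, 'd) info \<Rightarrow> real^'u) \<Rightarrow> bool" where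
  "minimizing_law A B G M V \<eta> \<longleftrightarrow>
     (\<forall>z. \<forall>r\<in>infos M. is_arg_min (\<lambda>u. bellman_u A B G M u V z r) (\<lambda>u. True) (\<eta> z r))"

definition info_policy ::
  "('z::finite, 'u::finite, 'd::finite) hmat set \<Rightarrow>
   (real^'z \<Rightarrow> ('z, 'u, 'd) info \<Rightarrow> real^'u) \<Rightarrow> ('z, 'u, 'd) policy" where
  "info_policy M \<eta> t zs us ds =
     \<eta> (zs ! t) (\<lambda>H\<in>M. \<Sum>s<t. sigma H (zs ! s) (us ! s) (ds ! s))"

end

theory Submission
  imports Defs
begin

text \<open>The Bellman operator is monotone because it is built from suprema and infima, and the value
  iteration is nondecreasing because against any fixed model the adversary can keep the stage cost
  nonnegative: the disturbance at which \<open>sigma H z u\<close> is critical turns the cost into the quadratic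
  form of the Schur complement, which is positive semidefinite
  (\<open>sigma_critical_disturbance\<close>, \<open>V_init_le_bellman\<close>). A nondecreasing sequence always has a limit in
  the extended reals, namely its supremum, so convergence to a finite limit is the same as
  boundedness.

  The analytic content is that the limit is a fixed point and that minimizers exist, that is, that
  a minimum over \<open>u\<close> can be exchanged with an increasing limit. This needs compactness in \<open>u\<close>.
  The iterates lie above \<open>V_init M\<close>, so \<open>bellman_u\<close> of an iterate is bounded below by the Schur form
  of a single model, which is coercive in \<open>u\<close> because its \<open>u\<close>-block is positive definite
  (\<open>schur_form_coercive\<close>). The iterates are lower semicontinuous for convergence of the state together with
  pointwise convergence of the information state (\<open>seq_lsc\<close>). Near-optimal inputs for the successive
  iterates therefore accumulate at an input that is optimal for all of them at once
  (\<open>common_minimizer\<close>). This one lemma shows that the Bellman operator preserves lower semicontinuity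
  and that the limit is a fixed point whose minima are attained.

  The value of the problem is squeezed between the two sides of the game. Whatever the policy, an
  adversary who looks \<open>k\<close> steps ahead forces a cost arbitrarily close to the \<open>k\<close>-th iterate at
  \<open>(z0, 0)\<close>, since states and inputs depend only on past disturbances
  (\<open>value_iteration_le_worst_case_cost\<close>). Conversely, under a law that attains the minimum, the limit
  never increases along a trajectory and dominates the accumulated cost
  (\<open>worst_case_cost_info_policy_le\<close>). Finiteness of the value at all \<open>z0\<close> concerns only the zero
  information state; it transfers to every information state that is bounded above because the iterates are
  monotone in the information state and commute with the addition of constants
  (\<open>value_iteration_le_shift\<close>).

  Uniqueness fails because the Bellman operator also commutes with the addition of constants
  to a value function, so that a finite fixed point can be shifted.\<close>

section \<open>Eliminating the disturbance from a stage cost\<close>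

definition stack :: "real^'a \<Rightarrow> real^'b \<Rightarrow> real^('a::finite + 'b::finite)" where
  "stack x y = (\<chi> i. case i of Inl a \<Rightarrow> x $ a | Inr b \<Rightarrow> y $ b)"

lemma stack_nth [simp]: "stack x y $ Inl a = x $ a" "stack x y $ Inr b = y $ b"
  by (simp_all add: stack_def)

lemma stack_diff: "stack x y - stack x' y' = stack (x - x') (y - y')"
  by (simp add: vec_eq_iff stack_def split: sum.split)

lemma sum_UNIV_Plus:
  fixes f :: "'a::finite + 'b::finite \<Rightarrow> real"
  shows "(\<Sum>i\<in>UNIV. f i) = (\<Sum>a\<in>UNIV. f (Inl a)) + (\<Sum>b\<in>UNIV. f (Inr b))"
  by (subst UNIV_Plus_UNIV[symmetric], subst sum.Plus) simp_all

lemma quadratic_form_stack: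
  fixes Q :: "real^('a::finite + 'b::finite)^('a + 'b)"
  shows "stack x y \<bullet> (Q *v stack x y)
    = x \<bullet> (block Inl Inl Q *v x) + x \<bullet> (block Inl Inr Q *v y)
      + y \<bullet> (block Inr Inl Q *v x) + y \<bullet> (block Inr Inr Q *v y)"
  by (simp add: inner_vec_def matrix_vector_mult_def block_def sum_UNIV_Plus
      distrib_left sum.distrib)

lemma sigma_eq_quadratic_form:
  "sigma H z u d = stack (stack z u) d \<bullet> (H *v stack (stack z u) d)"
  by (simp add: sigma_def inner_vec_def matrix_vector_mult_def block_def sum_UNIV_Plus
      distrib_left sum.distrib)

lemma uminus_matrix_vector_mult: "(- Q) *v v = - (Q *v (v :: real^'n))"
  by (simp add: matrix_vector_mult_def vec_eq_iff sum_negf)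

lemma negdef_matrix_inv:
  fixes D :: "real^'n^'n"
  assumes "negdef D"
  shows "D ** matrix_inv D = mat 1"
proof -
  have "v = 0" if "D *v v = 0" for v
  proof (rule ccontr)
    assume "v \<noteq> 0"
    then have "v \<bullet> (- D *v v) > 0"
      using assms by (simp add: negdef_def posdef_def)
    moreover have "- D *v v = 0"
      using that by (simp add: uminus_matrix_vector_mult)
    ultimately show False by simp
  qed
  then have "\<exists>D'. D' ** D = mat 1"
    by (simp add: matrix_left_invertible_ker)
  then have "invertible D"
    unfolding invertible_def by (metis matrix_left_right_inverse)
  then show ?thesis
    unfolding invertible_def matrix_inv_def by (rule someI2_ex) simp
qed

text \<open>Completing the square in \<open>d\<close>: at \<open>d = - D\<^sup>-\<^sup>1 F x\<close>, with \<open>D\<close> the \<open>d\<close>-block and \<open>F\<close> the block that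
  couples \<open>d\<close> to \<open>x = (z, u)\<close>, the two terms with \<open>d\<close> on the left cancel and the Schur form
  remains. For symmetric \<open>H\<close> this \<open>d\<close> is the maximizing disturbance, but all that is needed is that the
  value there is a lower bound for the supremum over \<open>d\<close>.\<close>

lemma sigma_critical_disturbance:
  assumes "negdef (block ix_d ix_d H)"
  obtains d where "sigma H z u d = stack z u \<bullet> (schur_d H *v stack z u)"
proof -
  define x where "x = stack z u"
  define D where "D = block Inr Inr H"
  define F where "F = block Inr Inl H"
  define d where "d = - (matrix_inv D *v (F *v x))"
  have "D *v d = - ((D ** matrix_inv D) *v (F *v x))"
    by (simp only: d_def vec.neg matrix_vector_mul_assoc matrix_mul_assoc)
  also have "\<dots> = - (F *v x)"
    using negdef_matrix_inv[of D] assms by (simp add: D_def)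
  finally have Dd: "D *v d = - (F *v x)" .
  have "sigma H z u d = x \<bullet> (block Inl Inl H *v x) + x \<bullet> (block Inl Inr H *v d)
      + d \<bullet> (F *v x) + d \<bullet> (D *v d)"
    by (simp add: sigma_eq_quadratic_form quadratic_form_stack x_def D_def F_def)
  also have "\<dots> = x \<bullet> (block Inl Inl H *v x) + x \<bullet> (block Inl Inr H *v d)"
    by (simp add: Dd)
  also have "\<dots> = x \<bullet> (schur_d H *v x)"
    by (simp add: schur_d_def d_def D_def F_def vec.neg matrix_vector_mult_diff_rdistrib
        inner_diff_right matrix_vector_mul_assoc[symmetric])
  finally show thesis
    using that x_def by blast
qed

text \<open>The constant \<open>m\<close> is the minimum of the form on the unit sphere; homogeneity does the rest.\<close>

lemma posdef_lower_bound:
  fixes R :: "real^'n^'n"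
  assumes "posdef R"
  obtains m where "m > 0" "\<And>u. m * (norm u)\<^sup>2 \<le> u \<bullet> (R *v u)"
proof -
  let ?S = "sphere (0::real^'n) 1"
  have "continuous_on ?S (\<lambda>u. u \<bullet> (R *v u))"
    by (intro continuous_intros linear_continuous_on matrix_vector_mul_bounded_linear)
  moreover have "compact ?S" "?S \<noteq> {}" by simp_all
  ultimately obtain v where v: "v \<in> ?S" "\<And>u. u \<in> ?S \<Longrightarrow> v \<bullet> (R *v v) \<le> u \<bullet> (R *v u)"
    using continuous_attains_inf[of ?S] by blast
  have "v \<noteq> 0" using v(1) by auto
  then have "v \<bullet> (R *v v) > 0"
    using assms by (simp add: posdef_def)
  moreover have "v \<bullet> (R *v v) * (norm u)\<^sup>2 \<le> u \<bullet> (R *v u)" for u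
  proof (cases "u = 0")
    case False
    define w where "w = (1 / norm u) *\<^sub>R u"
    have "w \<in> ?S" and u: "u = norm u *\<^sub>R w"
      using False by (simp_all add: w_def)
    have "v \<bullet> (R *v v) * (norm u)\<^sup>2 \<le> (w \<bullet> (R *v w)) * (norm u)\<^sup>2"
      by (intro mult_right_mono v(2) \<open>w \<in> ?S\<close>) simp
    also have "\<dots> = u \<bullet> (R *v u)"
      by (subst (2 3) u) (simp add: matrix_vector_mult_scaleR power2_eq_square)
    finally show ?thesis .
  qed simp
  ultimately show thesis by (rule that)
qed

text \<open>A positive semidefinite form \<open>q\<close> obeys \<open>q (a - b) \<le> 2 * q a + 2 * q b\<close>. With \<open>a = (z, u)\<close> and
  \<open>b = (z, 0)\<close> the difference is \<open>(0, u)\<close>, on which \<open>q\<close> is the positive definite form of the second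
  diagonal block. So the mixed terms need no estimate, and \<open>u\<close> is bounded as soon as \<open>z\<close> and
  \<open>q (z, u)\<close> are.\<close>

lemma schur_form_coercive:
  fixes Q :: "real^('a::finite + 'b::finite)^('a + 'b)"
  assumes Q: "possemidef Q" and R: "posdef (block Inr Inr Q)"
    and z: "Bseq zs" and le: "\<And>n. stack (zs n) (us n) \<bullet> (Q *v stack (zs n) (us n)) \<le> c"
  shows "bounded (range us)"
proof -
  obtain m where m: "m > 0" "\<And>u. m * (norm u)\<^sup>2 \<le> u \<bullet> (block Inr Inr Q *v u)"
    using posdef_lower_bound[OF R] by metis
  obtain K where K: "\<And>n. norm (zs n) \<le> K"
    using z by (metis BseqE)
  have "K \<ge> 0" using K[of 0] norm_ge_zero order_trans by blast
  define P where "P = block Inl Inl Q"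
  define L where "L = onorm ((*v) P)"
  have zz: "stack z 0 \<bullet> (Q *v stack z 0) \<le> L * K\<^sup>2" if "norm z \<le> K" for z
  proof -
    have "stack z 0 \<bullet> (Q *v stack z 0) = z \<bullet> (P *v z)"
      by (simp add: quadratic_form_stack P_def)
    also have "\<dots> \<le> norm z * norm (P *v z)"
      by (rule norm_cauchy_schwarz)
    also have "\<dots> \<le> norm z * (L * norm z)"
      unfolding L_def
      by (intro mult_left_mono onorm matrix_vector_mul_bounded_linear norm_ge_zero)
    also have "\<dots> = L * (norm z)\<^sup>2"
      by (simp add: power2_eq_square)
    also have "\<dots> \<le> L * K\<^sup>2"
      using that unfolding L_def
      by (intro mult_left_mono power_mono norm_ge_zero onorm_pos_le matrix_vector_mul_bounded_linear)
    finally show ?thesis .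
  qed
  have bound: "m * (norm (us n))\<^sup>2 \<le> 2 * c + 2 * (L * K\<^sup>2)" for n
  proof -
    let ?q = "\<lambda>y. y \<bullet> (Q *v y)"
    let ?a = "stack (zs n) (us n)" and ?b = "stack (zs n) 0"
    (* parallelogram law for the quadratic form *)
    have "?q (?a - ?b) + ?q (?a + ?b) = 2 * ?q ?a + 2 * ?q ?b"
      by (simp add: matrix_vector_mult_diff_distrib matrix_vector_right_distrib
          inner_diff_left inner_diff_right inner_add_left inner_add_right)
    moreover have "?q (?a + ?b) \<ge> 0"
      using Q by (simp add: possemidef_def)
    moreover have "?q (?a - ?b) = us n \<bullet> (block Inr Inr Q *v us n)"
      by (simp add: stack_diff quadratic_form_stack)
    ultimately show ?thesis
      using m(2)[of "us n"] le[of n] zz[OF K[of n]] by linarith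
  qed
  have "norm (us n) \<le> sqrt ((2 * c + 2 * (L * K\<^sup>2)) / m)" for n
    using bound[of n] m(1) by (intro real_le_rsqrt) (simp add: field_simps)
  then show ?thesis
    by (auto simp: bounded_iff)
qed

lemma model_setD:
  assumes "model_set M" "H \<in> M"
  shows "negdef (block ix_d ix_d H)" "possemidef (schur_d H)"
    "posdef (block Inr Inr (schur_d H))"
  using assms by (simp_all add: model_set_def)

section \<open>The Bellman operator\<close>

lemma info_step_in_infos: "info_step M r z u d \<in> infos M"
  by (simp add: info_step_def infos_def)

lemma bellman_u_mono:
  assumes "val_le M V W"
  shows "bellman_u A B G M u V z r \<le> bellman_u A B G M u W z r"
  unfolding bellman_u_def using assms
  by (intro SUP_mono') (simp add: val_le_def info_step_in_infos)

lemma bellman_mono: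
  assumes "val_le M V W"
  shows "val_le M (bellman A B G M V) (bellman A B G M W)"
  unfolding val_le_def bellman_def
  using bellman_u_mono[OF assms] by (auto intro: INF_mono')

lemma bellman_le: "bellman A B G M V z r \<le> bellman_u A B G M u V z r"
  unfolding bellman_def by (rule INF_lower) simp

text \<open>The source of both monotonicity (the form is nonnegative) and compactness (it is coercive in
  \<open>u\<close>). The disturbance is tuned to the single model \<open>H\<close>.\<close>

lemma schur_form_le_bellman_u:
  assumes "model_set M" "H \<in> M" "val_le M (V_init M) V"
  shows "ereal (r H + stack z u \<bullet> (schur_d H *v stack z u)) \<le> bellman_u A B G M u V z r"
proof -
  obtain d where d: "sigma H z u d = stack z u \<bullet> (schur_d H *v stack z u)"
    using sigma_critical_disturbance model_setD(1)[OF assms(1,2)] by metis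
  let ?z = "A *v z + B *v u + G *v d" and ?r = "info_step M r z u d"
  have "ereal (r H + stack z u \<bullet> (schur_d H *v stack z u)) = ereal (?r H)"
    using assms(2) by (simp add: info_step_def d)
  also have "\<dots> \<le> V_init M ?z ?r"
    unfolding V_init_def using assms(2) by (rule SUP_upper)
  also have "\<dots> \<le> V ?z ?r"
    using assms(3) by (simp add: val_le_def info_step_in_infos)
  also have "\<dots> \<le> bellman_u A B G M u V z r"
    unfolding bellman_u_def by (rule SUP_upper) simp
  finally show ?thesis .
qed

lemma V_init_le_bellman:
  assumes "model_set M" "val_le M (V_init M) V"
  shows "val_le M (V_init M) (bellman A B G M V)"
proof -
  have "ereal (r H) \<le> bellman_u A B G M u V z r" if "H \<in> M" for z r u H
  proof -
    have "ereal (r H) \<le> ereal (r H + stack z u \<bullet> (schur_d H *v stack z u))"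
      using model_setD(2)[OF assms(1) that] by (simp add: possemidef_def)
    also have "\<dots> \<le> bellman_u A B G M u V z r"
      by (rule schur_form_le_bellman_u[OF assms(1) that assms(2)])
    finally show ?thesis .
  qed
  then show ?thesis
    by (auto simp: val_le_def V_init_def bellman_def intro!: INF_greatest SUP_least)
qed

lemma V_init_gt_minus_infinity:
  assumes "model_set M"
  shows "V_init M z r > -\<infinity>"
proof -
  obtain H where "H \<in> M" using assms by (auto simp: model_set_def)
  then have "ereal (r H) \<le> V_init M z r"
    unfolding V_init_def by (rule SUP_upper)
  then show ?thesis
    using less_le_trans[of "-\<infinity>" "ereal (r H)"] by simp
qed

section \<open>Lower semicontinuity and attained minima\<close>

text \<open>Lower semicontinuity is expressed by sequential closedness of sublevel sets. Information states
  converge pointwise on \<open>M\<close>. That topology need not be metrizable, but sequences suffice because the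
  compactness argument extracts subsequences only from inputs, in a Euclidean space. The level
  \<open>c\<close> is extended real so that suprema of such functions are handled without case distinctions.\<close>

definition seq_lsc ::
  "('z::finite, 'u::finite, 'd::finite) hmat set \<Rightarrow> ('z, 'u, 'd) valfun \<Rightarrow> bool" where
  "seq_lsc M V \<longleftrightarrow> (\<forall>zs z rs r c.
     zs \<longlonglongrightarrow> z \<longrightarrow> range rs \<subseteq> infos M \<longrightarrow> r \<in> infos M \<longrightarrow>
     (\<forall>H\<in>M. (\<lambda>n. rs n H) \<longlonglongrightarrow> r H) \<longrightarrow> (\<forall>n. V (zs n) (rs n) \<le> c) \<longrightarrow> V z r \<le> c)"

lemma seq_lscD:
  assumes "seq_lsc M V" "zs \<longlonglongrightarrow> z" "range rs \<subseteq> infos M" "r \<in> infos M"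
    "\<And>H. H \<in> M \<Longrightarrow> (\<lambda>n. rs n H) \<longlonglongrightarrow> r H" "\<And>n. V (zs n) (rs n) \<le> c"
  shows "V z r \<le> c"
  using assms unfolding seq_lsc_def by blast

lemma seq_lsc_V_init: "seq_lsc M (V_init M)"
  unfolding seq_lsc_def V_init_def
proof (intro allI impI SUP_least)
  fix rs :: "nat \<Rightarrow> ('a, 'b, 'c) info" and r c H
  assume conv: "\<forall>H\<in>M. (\<lambda>n. rs n H) \<longlonglongrightarrow> r H"
    and le: "\<forall>n. (SUP H\<in>M. ereal (rs n H)) \<le> c" and H: "H \<in> M"
  have lim: "(\<lambda>n. ereal (rs n H)) \<longlonglongrightarrow> ereal (r H)"
    using conv H by simp
  have bound: "ereal (rs n H) \<le> c" for n
    using le H by (simp add: SUP_le_iff)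
  show "ereal (r H) \<le> c"
    by (intro LIMSEQ_le_const2[OF lim] exI allI impI bound)
qed

lemma tendsto_sigma:
  assumes "zs \<longlonglongrightarrow> z" "us \<longlonglongrightarrow> u"
  shows "(\<lambda>n. sigma H (zs n) (us n) d) \<longlonglongrightarrow> sigma H z u d"
  unfolding sigma_def
  by (intro tendsto_intros assms bounded_linear.tendsto[OF matrix_vector_mul_bounded_linear])

text \<open>Choose \<open>us n\<close> optimal for \<open>V n\<close> at \<open>(zs n, rs n)\<close> up to \<open>1 / Suc n\<close>. Coercivity bounds these inputs, so
  a subsequence converges to some \<open>u\<close>. For fixed \<open>j\<close>, \<open>us n\<close> is also nearly admissible for \<open>V j\<close> once
  \<open>n \<ge> j\<close>, as the sequence \<open>V\<close> increases, and lower semicontinuity of \<open>V j\<close> passes the bound to \<open>u\<close>.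
  A constant sequence \<open>V\<close> gives lower semicontinuity of the Bellman operator; constant \<open>zs\<close> and \<open>rs\<close>
  give the fixed-point property of the limit.\<close>

lemma common_minimizer:
  fixes V :: "nat \<Rightarrow> ('z::finite, 'u::finite, 'd::finite) valfun"
  assumes M: "model_set M"
    and lsc: "\<And>n. seq_lsc M (V n)" and ge: "\<And>n. val_le M (V_init M) (V n)"
    and mono: "\<And>m n. m \<le> n \<Longrightarrow> val_le M (V m) (V n)"
    and zs: "zs \<longlonglongrightarrow> z" and rs: "\<And>H. H \<in> M \<Longrightarrow> (\<lambda>n. rs n H) \<longlonglongrightarrow> r H"
    and le: "\<And>n. bellman A B G M (V n) (zs n) (rs n) \<le> ereal c"
  shows "\<exists>u. \<forall>j. bellman_u A B G M u (V j) z r \<le> ereal c"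
proof -
  have "\<forall>n. \<exists>u. bellman_u A B G M u (V n) (zs n) (rs n) < ereal (c + 1 / Suc n)"
  proof
    fix n
    have "bellman A B G M (V n) (zs n) (rs n) < ereal (c + 1 / Suc n)"
      using le[of n] by (rule le_less_trans) simp
    then show "\<exists>u. bellman_u A B G M u (V n) (zs n) (rs n) < ereal (c + 1 / Suc n)"
      unfolding bellman_def INF_less_iff by blast
  qed
  then obtain us where us:
      "\<And>n. bellman_u A B G M (us n) (V n) (zs n) (rs n) < ereal (c + 1 / Suc n)"
    unfolding choice_iff by blast
  obtain H where H: "H \<in> M" using M by (auto simp: model_set_def)
  let ?q = "\<lambda>n. stack (zs n) (us n) \<bullet> (schur_d H *v stack (zs n) (us n))"
  obtain K where K: "\<And>n. \<bar>rs n H\<bar> \<le> K"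
    using convergent_imp_Bseq[OF convergentI[OF rs[OF H]]] unfolding Bseq_def real_norm_def by blast
  have "?q n \<le> c + 1 + K" for n
  proof -
    have "ereal (rs n H + ?q n) < ereal (c + 1 / Suc n)"
      using schur_form_le_bellman_u[OF M H ge] us[of n] by (rule le_less_trans)
    then have "rs n H + ?q n < c + 1 / real (Suc n)"
      by (simp only: less_ereal.simps)
    moreover have "1 / real (Suc n) \<le> 1" by simp
    ultimately show ?thesis
      using K[of n] by linarith
  qed
  then have "bounded (range us)"
    using convergent_imp_Bseq[OF convergentI[OF zs]]
    by (rule schur_form_coercive[OF model_setD(2,3)[OF M H], rotated])
  then obtain u \<phi> where \<phi>: "strict_mono \<phi>" and u: "(us \<circ> \<phi>) \<longlonglongrightarrow> u"
    using bounded_imp_convergent_subsequence by blast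
  have "V j (A *v z + B *v u + G *v d) (info_step M r z u d) \<le> ereal c + ereal e"
    if e: "e > 0" for j d e
  proof -
    obtain N where N: "1 / real (Suc N) < e"
      using nat_approx_posE[OF e] by blast
    (* The tail of the subsequence on which V j is below V (k n) and the slack is below e. *)
    define k where "k n = \<phi> (n + (j + N))" for n
    have k: "n + (j + N) \<le> k n" for n
      unfolding k_def using \<phi> by (rule seq_suble)
    have klim: "filterlim k sequentially sequentially"
      unfolding k_def
      by (rule filterlim_compose[OF filterlim_subseq[OF \<phi>] filterlim_add_const_nat_at_top])
    have zk: "(\<lambda>n. zs (k n)) \<longlonglongrightarrow> z"
      by (rule filterlim_compose[OF zs klim])
    have rk: "(\<lambda>n. rs (k n) H) \<longlonglongrightarrow> r H" if "H \<in> M" for H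
      by (rule filterlim_compose[OF rs[OF that] klim])
    have uk: "(\<lambda>n. us (k n)) \<longlonglongrightarrow> u"
      using LIMSEQ_ignore_initial_segment[OF u, of "j + N"] by (simp add: k_def)
    show ?thesis
    proof (rule seq_lscD[OF lsc[of j]])
      show "(\<lambda>n. A *v zs (k n) + B *v us (k n) + G *v d) \<longlonglongrightarrow> A *v z + B *v u + G *v d"
        by (intro tendsto_intros zk uk bounded_linear.tendsto[OF matrix_vector_mul_bounded_linear])
      show "(\<lambda>n. info_step M (rs (k n)) (zs (k n)) (us (k n)) d H) \<longlonglongrightarrow> info_step M r z u d H"
        if "H \<in> M" for H
        using tendsto_add[OF rk[OF that] tendsto_sigma[OF zk uk]] that by (simp add: info_step_def)
      show "V j (A *v zs (k n) + B *v us (k n) + G *v d)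
          (info_step M (rs (k n)) (zs (k n)) (us (k n)) d) \<le> ereal c + ereal e" for n
      proof -
        have "1 / real (Suc (k n)) \<le> 1 / real (Suc N)"
          using k[of n] by (intro divide_left_mono) auto
        then have small: "ereal (c + 1 / Suc (k n)) \<le> ereal c + ereal e"
          using N by simp
        have "V j (A *v zs (k n) + B *v us (k n) + G *v d)
            (info_step M (rs (k n)) (zs (k n)) (us (k n)) d)
          \<le> bellman_u A B G M (us (k n)) (V j) (zs (k n)) (rs (k n))"
          unfolding bellman_u_def by (rule SUP_upper) simp
        also have "\<dots> \<le> bellman_u A B G M (us (k n)) (V (k n)) (zs (k n)) (rs (k n))"
          using k[of n] by (intro bellman_u_mono mono) simp
        also have "\<dots> \<le> ereal c + ereal e"
          by (rule order_trans[OF less_imp_le[OF us] small])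
        finally show ?thesis .
      qed
    qed (auto simp: info_step_in_infos)
  qed
  then have le_c: "V j (A *v z + B *v u + G *v d) (info_step M r z u d) \<le> ereal c" for j d
    by (rule ereal_le_epsilon2)
  have "bellman_u A B G M u (V j) z r \<le> ereal c" for j
    unfolding bellman_u_def by (intro SUP_least le_c)
  then show ?thesis by blast
qed

lemma seq_lsc_bellman:
  assumes M: "model_set M" and lsc: "seq_lsc M V" and ge: "val_le M (V_init M) V"
  shows "seq_lsc M (bellman A B G M V)"
  unfolding seq_lsc_def
proof (intro allI impI)
  fix zs z rs r c
  assume zs: "zs \<longlonglongrightarrow> z" and infos: "range rs \<subseteq> infos M"
    and rs: "\<forall>H\<in>M. (\<lambda>n. rs n H) \<longlonglongrightarrow> r H"
    and le: "\<forall>n. bellman A B G M V (zs n) (rs n) \<le> c"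
  have "-\<infinity> < V_init M (zs 0) (rs 0)"
    using M by (rule V_init_gt_minus_infinity)
  also have "\<dots> \<le> bellman A B G M V (zs 0) (rs 0)"
    using V_init_le_bellman[OF M ge, of A B G] infos by (simp add: val_le_def range_subsetD)
  also have "\<dots> \<le> c"
    using le by simp
  finally have "c \<noteq> -\<infinity>" by simp
  show "bellman A B G M V z r \<le> c"
  proof (cases c)
    case (real c')
    then obtain u where "bellman_u A B G M u V z r \<le> c"
      using common_minimizer[of M "\<lambda>_. V", OF M lsc ge _ zs, of rs r] rs le
      by (force simp: val_le_def)
    then show ?thesis
      using bellman_le order_trans by blast
  qed (use \<open>c \<noteq> -\<infinity>\<close> in auto)
qed

section \<open>Value iteration and its limit\<close>

lemma value_iteration_regular:
  assumes "model_set M"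
  shows "seq_lsc M (value_iteration A B G M k) \<and> val_le M (V_init M) (value_iteration A B G M k)"
proof (induction k)
  case 0
  show ?case by (simp add: seq_lsc_V_init val_le_def)
next
  case (Suc k)
  then show ?case
    using seq_lsc_bellman[OF assms] V_init_le_bellman[OF assms] by simp
qed

lemma value_iteration_mono_Suc:
  assumes "model_set M"
  shows "val_le M (value_iteration A B G M k) (value_iteration A B G M (Suc k))"
proof (induction k)
  case 0
  then show ?case
    using V_init_le_bellman[OF assms] by (simp add: val_le_def)
next
  case (Suc k)
  then show ?case
    using bellman_mono by simp
qed

lemma incseq_value_iteration:
  assumes "model_set M" "r \<in> infos M"
  shows "incseq (\<lambda>k. value_iteration A B G M k z r)"
  using value_iteration_mono_Suc[OF assms(1)] assms(2)
  by (intro incseq_SucI) (simp add: val_le_def del: value_iteration.simps)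

lemma value_iteration_mono:
  assumes "model_set M" "m \<le> n"
  shows "val_le M (value_iteration A B G M m) (value_iteration A B G M n)"
  using incseq_value_iteration[OF assms(1)] assms(2)
  by (auto simp: val_le_def incseq_def)

lemma limit_eq_SUP:
  assumes "model_set M" "value_iteration_limit A B G M V" "r \<in> infos M"
  shows "V z r = (SUP k. value_iteration A B G M k z r)"
proof (rule LIMSEQ_unique)
  show "(\<lambda>k. value_iteration A B G M k z r) \<longlonglongrightarrow> V z r"
    using assms by (simp add: value_iteration_limit_def)
  show "(\<lambda>k. value_iteration A B G M k z r) \<longlonglongrightarrow> (SUP k. value_iteration A B G M k z r)"
    using incseq_value_iteration[OF assms(1,3)] by (rule LIMSEQ_SUP)
qed

lemma value_iteration_le_limit:
  assumes "model_set M" "value_iteration_limit A B G M V"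
  shows "val_le M (value_iteration A B G M k) V"
  by (auto simp: val_le_def limit_eq_SUP[OF assms] intro: SUP_upper)

lemma converges_iff_bounded:
  assumes M: "model_set M"
  shows "value_iteration_converges A B G M \<longleftrightarrow> value_iteration_bounded A B G M"
proof
  assume "value_iteration_converges A B G M"
  then obtain V where V: "value_iteration_limit A B G M V"
    by (auto simp: value_iteration_converges_def)
  show "value_iteration_bounded A B G M"
    unfolding value_iteration_bounded_def
  proof (intro allI ballI impI)
    fix z :: "real^'a" and r
    assume r: "r \<in> infos M" and fin: "V_init M z r < \<infinity>"
    then have "\<bar>V z r\<bar> \<noteq> \<infinity>"
      using V by (auto simp: value_iteration_limit_def finite_valued_def)
    then obtain b where b: "V z r = ereal b" by auto
    obtain a where a: "V_init M z r = ereal a"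
      using fin V_init_gt_minus_infinity[OF M, of z r] by (cases "V_init M z r") auto
    have "\<bar>value_iteration A B G M k z r\<bar> \<le> ereal (\<bar>a\<bar> + \<bar>b\<bar>)" for k
    proof -
      have "ereal a \<le> value_iteration A B G M k z r"
        using value_iteration_regular[OF M] r a by (metis val_le_def)
      moreover have "value_iteration A B G M k z r \<le> ereal b"
        using value_iteration_le_limit[OF M V] r b by (metis val_le_def)
      ultimately show ?thesis
        by (cases "value_iteration A B G M k z r") auto
    qed
    then show "\<exists>c. \<forall>k. \<bar>value_iteration A B G M k z r\<bar> \<le> ereal c" by blast
  qed
next
  assume bdd: "value_iteration_bounded A B G M"
  define V where "V z r = (SUP k. value_iteration A B G M k z r)" for z r
  have "finite_valued M V"
    unfolding finite_valued_def
  proof (intro allI ballI impI)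
    fix z :: "real^'a" and r
    assume r: "r \<in> infos M" and fin: "V_init M z r < \<infinity>"
    then obtain c where c: "\<And>k. \<bar>value_iteration A B G M k z r\<bar> \<le> ereal c"
      using bdd unfolding value_iteration_bounded_def by blast
    have abs_le: "x \<le> y" if "\<bar>x\<bar> \<le> y" for x y :: ereal
      using that by (cases x; cases y) auto
    have "V z r \<le> ereal c"
      unfolding V_def using c by (intro SUP_least) (meson abs_le)
    moreover have "V_init M z r \<le> V z r"
      unfolding V_def using SUP_upper[of 0 UNIV "\<lambda>k. value_iteration A B G M k z r"] by simp
    ultimately show "\<bar>V z r\<bar> \<noteq> \<infinity>"
      using V_init_gt_minus_infinity[OF M, of z r] by auto
  qed
  moreover have "(\<lambda>k. value_iteration A B G M k z r) \<longlonglongrightarrow> V z r" if "r \<in> infos M" for z r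
    unfolding V_def using incseq_value_iteration[OF M that] by (rule LIMSEQ_SUP)
  ultimately show "value_iteration_converges A B G M"
    unfolding value_iteration_converges_def value_iteration_limit_def by blast
qed

text \<open>\<open>V \<le> bellman V\<close> follows from monotonicity. For the converse, \<open>common_minimizer\<close> supplies an input
  that keeps every iterate below \<open>V z r\<close>, hence also their supremum \<open>V\<close>; the same input attains the
  minimum. Where \<open>V z r\<close> is infinite every input is a minimizer.\<close>

lemma limit_fixed_point_minimizer:
  assumes M: "model_set M" and V: "value_iteration_limit A B G M V" and r: "r \<in> infos M"
  shows "bellman A B G M V z r = V z r" and "\<exists>u. bellman_u A B G M u V z r = V z r"
proof -
  let ?V = "value_iteration A B G M"
  have "?V k z r \<le> bellman A B G M V z r" for k
  proof -
    have "?V k z r \<le> ?V (Suc k) z r"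
      using value_iteration_mono_Suc[OF M] r unfolding val_le_def by blast
    also have "\<dots> \<le> bellman A B G M V z r"
      using bellman_mono[OF value_iteration_le_limit[OF M V]] r by (simp add: val_le_def)
    finally show ?thesis .
  qed
  then have up: "V z r \<le> bellman A B G M V z r"
    by (simp add: limit_eq_SUP[OF M V r] SUP_least)
  have "\<exists>u. bellman_u A B G M u V z r \<le> V z r"
  proof (cases "V z r")
    case (real c)
    have "bellman A B G M (?V n) z r \<le> ereal c" for n
      using value_iteration_le_limit[OF M V, of "Suc n"] r
      unfolding val_le_def real[symmetric] value_iteration.simps by blast
    then have "\<exists>u. \<forall>j. bellman_u A B G M u (?V j) z r \<le> ereal c"
      by (intro common_minimizer[OF M, where zs = "\<lambda>_. z" and rs = "\<lambda>_. r"]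
          conjunct1[OF value_iteration_regular[OF M]] conjunct2[OF value_iteration_regular[OF M]]
          value_iteration_mono[OF M] tendsto_const)
    then obtain u where u: "\<And>j. bellman_u A B G M u (?V j) z r \<le> ereal c"
      by blast
    have "bellman_u A B G M u V z r \<le> ereal c"
      unfolding bellman_u_def limit_eq_SUP[OF M V info_step_in_infos]
    proof (intro SUP_least)
      fix d j
      have "?V j (A *v z + B *v u + G *v d) (info_step M r z u d) \<le> bellman_u A B G M u (?V j) z r"
        unfolding bellman_u_def by (rule SUP_upper) simp
      also note u
      finally show "?V j (A *v z + B *v u + G *v d) (info_step M r z u d) \<le> ereal c" .
    qed
    then show ?thesis using real by auto
  next
    case MInf
    have "V_init M z r \<le> V z r"
      using value_iteration_le_limit[OF M V, of 0] r by (simp add: val_le_def)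
    then show ?thesis
      using V_init_gt_minus_infinity[OF M, of z r] MInf by simp
  qed auto
  then obtain u where u: "bellman_u A B G M u V z r \<le> V z r" by blast
  show "bellman A B G M V z r = V z r"
    by (rule antisym[OF order_trans[OF bellman_le u] up])
  show "\<exists>u. bellman_u A B G M u V z r = V z r"
    using antisym[OF u order_trans[OF up bellman_le]] by blast
qed

lemma limit_least_fixed_point:
  assumes M: "model_set M" and V: "value_iteration_limit A B G M V"
    and W: "fixed_point A B G M W" "val_le M (V_init M) W"
  shows "val_le M V W"
proof -
  have "val_le M (value_iteration A B G M k) W" for k
  proof (induction k)
    case (Suc k)
    show ?case
      using bellman_mono[OF Suc, of A B G] W(1) by (simp add: val_le_def fixed_point_def)
  qed (use W in simp)
  then show ?thesis
    by (auto simp: val_le_def limit_eq_SUP[OF M V] intro!: SUP_least)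
qed

text \<open>Reduces the growth of the iterates at any information state bounded above by \<open>c\<close> to their growth
  at the zero information state.\<close>

lemma value_iteration_le_shift:
  assumes "\<And>H. H \<in> M \<Longrightarrow> r H \<le> r' H + c"
  shows "value_iteration A B G M k z r \<le> value_iteration A B G M k z r' + ereal c"
  using assms
proof (induction k arbitrary: z r r')
  case 0
  show ?case
    unfolding value_iteration.simps V_init_def
  proof (rule SUP_least)
    fix H assume H: "H \<in> M"
    have "ereal (r H) \<le> ereal (r' H) + ereal c"
      using 0[OF H] by simp
    also have "\<dots> \<le> (SUP H\<in>M. ereal (r' H)) + ereal c"
      using H by (intro add_right_mono SUP_upper)
    finally show "ereal (r H) \<le> (SUP H\<in>M. ereal (r' H)) + ereal c" .
  qed
next
  case (Suc k)
  let ?V = "value_iteration A B G M k"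
  have "bellman A B G M ?V z r - ereal c \<le> bellman_u A B G M u ?V z r'" for u
  proof -
    have "bellman_u A B G M u ?V z r \<le> bellman_u A B G M u ?V z r' + ereal c"
      unfolding bellman_u_def
    proof (rule SUP_least)
      fix d
      let ?z = "A *v z + B *v u + G *v d"
      have "?V ?z (info_step M r z u d) \<le> ?V ?z (info_step M r' z u d) + ereal c"
        using Suc.prems by (intro Suc.IH) (simp add: info_step_def)
      also have "\<dots> \<le> (SUP d. ?V (A *v z + B *v u + G *v d) (info_step M r' z u d)) + ereal c"
        by (intro add_right_mono SUP_upper) simp
      finally show "?V ?z (info_step M r z u d) \<le> \<dots>" .
    qed
    then have "bellman A B G M ?V z r \<le> bellman_u A B G M u ?V z r' + ereal c"
      by (rule order_trans[OF bellman_le])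
    then show ?thesis
      by (simp add: ereal_minus_le_iff add.commute)
  qed
  then have "bellman A B G M ?V z r - ereal c \<le> bellman A B G M ?V z r'"
    unfolding bellman_def[of A B G M ?V z r'] by (rule INF_greatest)
  then show ?case
    by (simp add: ereal_minus_le_iff add.commute)
qed

section \<open>Closed-loop trajectories\<close>

lemma history_causal:
  assumes "\<And>s. s < t \<Longrightarrow> d s = d' s"
  shows "history A B G \<mu> z0 d t = history A B G \<mu> z0 d' t"
  using assms
proof (induction t)
  case (Suc t)
  have "map d [0..<t] = map d' [0..<t]"
    using Suc.prems by simp
  moreover have "history A B G \<mu> z0 d t = history A B G \<mu> z0 d' t"
    using Suc by simp
  ultimately show ?case
    using Suc.prems[of t] by (simp only: history.simps lessI)
qed simp

lemma state_input_causal: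
  assumes "\<And>s. s < t \<Longrightarrow> d s = d' s"
  shows "state A B G \<mu> z0 d t = state A B G \<mu> z0 d' t"
    and "input A B G \<mu> z0 d t = input A B G \<mu> z0 d' t"
proof -
  have "map d [0..<t] = map d' [0..<t]"
    using assms by simp
  then show "state A B G \<mu> z0 d t = state A B G \<mu> z0 d' t"
    and "input A B G \<mu> z0 d t = input A B G \<mu> z0 d' t"
    using history_causal[of t d d' A B G \<mu> z0] assms
    by (simp_all only: state_def input_def)
qed

definition info_at where
  "info_at A B G M \<mu> z0 d t = (\<lambda>H\<in>M. cost A B G \<mu> t z0 H d)"

lemma info_at_0: "info_at A B G M \<mu> z0 d 0 = info_zero M"
  by (simp add: info_at_def info_zero_def cost_def)

lemma info_at_Suc:
  "info_at A B G M \<mu> z0 d (Suc t)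
   = info_step M (info_at A B G M \<mu> z0 d t) (state A B G \<mu> z0 d t) (input A B G \<mu> z0 d t) (d t)"
  by (auto simp: info_at_def info_step_def cost_def)

lemma info_at_in_infos: "info_at A B G M \<mu> z0 d t \<in> infos M"
  by (simp add: info_at_def infos_def)

lemma info_at_causal:
  assumes "\<And>s. s < t \<Longrightarrow> d s = d' s"
  shows "info_at A B G M \<mu> z0 d t = info_at A B G M \<mu> z0 d' t"
proof -
  have "state A B G \<mu> z0 d s = state A B G \<mu> z0 d' s"
    "input A B G \<mu> z0 d s = input A B G \<mu> z0 d' s" if "s < t" for s
    using that assms by (auto intro: state_input_causal)
  then show ?thesis
    using assms by (simp add: info_at_def cost_def)
qed

text \<open>Induction on the number \<open>k\<close> of remaining steps, for all times and disturbances. By causality, changing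
  \<open>d t\<close> to \<open>\<delta>\<close> leaves the state, the input and the information state at time \<open>t\<close> unchanged, so every
  successor in the supremum \<open>bellman_u\<close> lies on another trajectory of the same policy. No
  maximizing disturbance has to exist.\<close>

lemma value_iteration_le_worst_case_cost:
  "value_iteration A B G M k (state A B G \<mu> z0 d t) (info_at A B G M \<mu> z0 d t)
   \<le> worst_case_cost A B G M \<mu> z0"
proof (induction k arbitrary: d t)
  case 0
  have "ereal (cost A B G \<mu> t z0 H d) \<le> worst_case_cost A B G M \<mu> z0" if "H \<in> M" for H
    unfolding worst_case_cost_def
    using that by (auto intro: SUP_upper2[of "(H, d, t)"])
  then show ?case
    by (simp add: V_init_def info_at_def SUP_least)
next
  case (Suc k)
  let ?V = "value_iteration A B G M k"
  let ?z = "state A B G \<mu> z0 d t" and ?u = "input A B G \<mu> z0 d t"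
    and ?r = "info_at A B G M \<mu> z0 d t"
  have "?V (A *v ?z + B *v ?u + G *v \<delta>) (info_step M ?r ?z ?u \<delta>) \<le> worst_case_cost A B G M \<mu> z0"
    for \<delta>
  proof -
    let ?d = "d(t := \<delta>)"
    have "state A B G \<mu> z0 ?d t = ?z" "input A B G \<mu> z0 ?d t = ?u"
      "info_at A B G M \<mu> z0 ?d t = ?r"
      by (rule state_input_causal info_at_causal; simp)+
    then show ?thesis
      using Suc.IH[of ?d "Suc t"] by (simp only: closed_loop(2) info_at_Suc fun_upd_same)
  qed
  then have "bellman_u A B G M ?u ?V ?z ?r \<le> worst_case_cost A B G M \<mu> z0"
    unfolding bellman_u_def by (rule SUP_least)
  then show ?case
    unfolding value_iteration.simps by (rule order_trans[OF bellman_le])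
qed

lemma value_iteration_le_problem_value:
  "value_iteration A B G M k z0 (info_zero M) \<le> problem_value A B G M z0"
  unfolding problem_value_def
proof (rule INF_greatest)
  fix \<mu> :: "('a, 'b, 'c) policy"
  show "value_iteration A B G M k z0 (info_zero M) \<le> worst_case_cost A B G M \<mu> z0"
    using value_iteration_le_worst_case_cost[of A B G M k \<mu> z0 "\<lambda>_. 0" 0]
    by (simp add: closed_loop(1) info_at_0)
qed

lemma input_info_policy:
  "input A B G (info_policy M \<eta>) z0 d t
   = \<eta> (state A B G (info_policy M \<eta>) z0 d t) (info_at A B G M (info_policy M \<eta>) z0 d t)"
proof -
  let ?x = "state A B G (info_policy M \<eta>) z0 d" and ?u = "input A B G (info_policy M \<eta>) z0 d"
  have nth: "map ?x [0..<Suc t] ! s = ?x s" if "s \<le> t" for s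
    using that by (subst nth_map) (simp_all add: nth_upt del: upt_Suc)
  have "?u t = \<eta> (map ?x [0..<Suc t] ! t)
      (\<lambda>H\<in>M. \<Sum>s<t. sigma H (map ?x [0..<Suc t] ! s) (map ?u [0..<t] ! s) (map d [0..<t] ! s))"
    by (subst closed_loop(3)) (simp only: info_policy_def)
  also have "\<dots> = \<eta> (?x t) (info_at A B G M (info_policy M \<eta>) z0 d t)"
    by (simp add: nth info_at_def cost_def del: upt_Suc)
  finally show ?thesis .
qed

text \<open>A Lyapunov argument: \<open>V\<close> does not increase along closed-loop trajectories, and at time \<open>N\<close> it
  dominates \<open>V_init M\<close> at the information state, which is the largest accumulated cost.\<close>

lemma worst_case_cost_info_policy_le:
  assumes ge: "val_le M (V_init M) V"
    and step: "\<And>z r. r \<in> infos M \<Longrightarrow> bellman_u A B G M (\<eta> z r) V z r \<le> V z r"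
  shows "worst_case_cost A B G M (info_policy M \<eta>) z0 \<le> V z0 (info_zero M)"
proof -
  let ?\<mu> = "info_policy M \<eta>"
  have dec: "V (state A B G ?\<mu> z0 d t) (info_at A B G M ?\<mu> z0 d t) \<le> V z0 (info_zero M)" for d t
  proof (induction t)
    case 0
    show ?case by (simp add: closed_loop(1) info_at_0)
  next
    case (Suc t)
    let ?z = "state A B G ?\<mu> z0 d t" and ?r = "info_at A B G M ?\<mu> z0 d t"
    have "V (state A B G ?\<mu> z0 d (Suc t)) (info_at A B G M ?\<mu> z0 d (Suc t))
        \<le> bellman_u A B G M (\<eta> ?z ?r) V ?z ?r"
      unfolding bellman_u_def closed_loop(2) info_at_Suc input_info_policy
      by (rule SUP_upper) simp
    also have "\<dots> \<le> V ?z ?r"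
      by (rule step[OF info_at_in_infos])
    also note Suc
    finally show ?case .
  qed
  have "ereal (cost A B G ?\<mu> N z0 H d) \<le> V z0 (info_zero M)" if "H \<in> M" for N H d
  proof -
    let ?z = "state A B G ?\<mu> z0 d N" and ?r = "info_at A B G M ?\<mu> z0 d N"
    have "ereal (cost A B G ?\<mu> N z0 H d) \<le> V_init M ?z ?r"
      unfolding V_init_def using that by (intro SUP_upper2[of H]) (auto simp: info_at_def)
    also have "\<dots> \<le> V ?z ?r"
      using ge info_at_in_infos unfolding val_le_def by blast
    also note dec
    finally show ?thesis .
  qed
  then show ?thesis
    unfolding worst_case_cost_def by (auto intro!: SUP_least)
qed

section \<open>Value of the problem and optimal policies\<close>

lemma minimizing_law_iff:
  "minimizing_law A B G M V \<eta> \<longleftrightarrow>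
     (\<forall>z. \<forall>r\<in>infos M. bellman_u A B G M (\<eta> z r) V z r = bellman A B G M V z r)"
proof -
  have "is_arg_min (\<lambda>u. bellman_u A B G M u V z r) (\<lambda>u. True) v
      \<longleftrightarrow> bellman_u A B G M v V z r = bellman A B G M V z r" for z r v
  proof
    assume "is_arg_min (\<lambda>u. bellman_u A B G M u V z r) (\<lambda>u. True) v"
    then have "bellman_u A B G M v V z r \<le> bellman A B G M V z r"
      unfolding bellman_def by (intro INF_greatest) (simp add: is_arg_min_def not_less)
    then show "bellman_u A B G M v V z r = bellman A B G M V z r"
      using bellman_le by (rule antisym)
  next
    assume "bellman_u A B G M v V z r = bellman A B G M V z r"
    then show "is_arg_min (\<lambda>u. bellman_u A B G M u V z r) (\<lambda>u. True) v"
      using bellman_le[of A B G M V z r] by (simp add: is_arg_min_def not_less)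
  qed
  then show ?thesis
    by (simp add: minimizing_law_def)
qed

lemma exists_minimizing_law:
  assumes "model_set M" "value_iteration_limit A B G M V"
  shows "\<exists>\<eta>. minimizing_law A B G M V \<eta>"
proof -
  have "\<forall>z r. \<exists>u. r \<in> infos M \<longrightarrow> bellman_u A B G M u V z r = bellman A B G M V z r"
    using limit_fixed_point_minimizer[OF assms] by metis
  then show ?thesis
    unfolding minimizing_law_iff by metis
qed

lemma minimizing_law_worst_case_cost:
  assumes M: "model_set M" and V: "value_iteration_limit A B G M V"
    and \<eta>: "minimizing_law A B G M V \<eta>"
  shows "worst_case_cost A B G M (info_policy M \<eta>) z0 = V z0 (info_zero M)"
    and "problem_value A B G M z0 = V z0 (info_zero M)"
proof -
  have zero: "info_zero M \<in> infos M"
    by (simp add: info_zero_def infos_def)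
  have "worst_case_cost A B G M (info_policy M \<eta>) z0 \<le> V z0 (info_zero M)"
  proof (rule worst_case_cost_info_policy_le)
    show "val_le M (V_init M) V"
      using value_iteration_le_limit[OF M V, of 0] by simp
    show "bellman_u A B G M (\<eta> z r) V z r \<le> V z r" if "r \<in> infos M" for z r
      using \<eta> limit_fixed_point_minimizer(1)[OF M V that] that by (simp add: minimizing_law_iff)
  qed
  moreover have "problem_value A B G M z0 \<le> worst_case_cost A B G M (info_policy M \<eta>) z0"
    unfolding problem_value_def by (rule INF_lower) simp
  moreover have "V z0 (info_zero M) \<le> problem_value A B G M z0"
    unfolding limit_eq_SUP[OF M V zero]
    by (intro SUP_least value_iteration_le_problem_value)
  ultimately show "worst_case_cost A B G M (info_policy M \<eta>) z0 = V z0 (info_zero M)"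
    and "problem_value A B G M z0 = V z0 (info_zero M)"
    by auto
qed

lemma V_init_info_zero:
  assumes "model_set M"
  shows "V_init M z (info_zero M) = 0"
  using assms by (simp add: V_init_def info_zero_def model_set_def zero_ereal_def)

text \<open>If the value is finite, it bounds the iterates at the zero information state, and
  \<open>value_iteration_le_shift\<close> carries the bound to the others. If the iteration converges, the value equals
  the limit at the zero information state.\<close>

lemma finite_value_iff_converges:
  assumes M: "model_set M"
  shows "(\<forall>z0. \<bar>problem_value A B G M z0\<bar> \<noteq> \<infinity>) \<longleftrightarrow> value_iteration_converges A B G M"
proof
  assume fin: "\<forall>z0. \<bar>problem_value A B G M z0\<bar> \<noteq> \<infinity>"
  have "value_iteration_bounded A B G M"
    unfolding value_iteration_bounded_def
  proof (intro allI ballI impI)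
    fix z :: "real^'a" and r
    assume r: "r \<in> infos M" and "V_init M z r < \<infinity>"
    then obtain a where a: "V_init M z r = ereal a"
      using V_init_gt_minus_infinity[OF M, of z r] by (cases "V_init M z r") auto
    obtain p where p: "problem_value A B G M z = ereal p"
      using fin[rule_format, of z] by auto
    have "r H \<le> info_zero M H + a" if "H \<in> M" for H
    proof -
      have "ereal (r H) \<le> V_init M z r"
        unfolding V_init_def using that by (rule SUP_upper)
      then show ?thesis using a that by (simp add: info_zero_def)
    qed
    then have shift: "value_iteration A B G M k z r
        \<le> value_iteration A B G M k z (info_zero M) + ereal a" for k
      by (rule value_iteration_le_shift)
    have "\<bar>value_iteration A B G M k z r\<bar> \<le> ereal (\<bar>a\<bar> + \<bar>p\<bar>)" for k
    proof -
      have "ereal a \<le> value_iteration A B G M k z r"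
        using value_iteration_regular[OF M] r a by (metis val_le_def)
      moreover have "value_iteration A B G M k z r \<le> ereal p + ereal a"
        using shift[of k] value_iteration_le_problem_value[of A B G M k z] p
        by (metis add_right_mono order_trans)
      ultimately show ?thesis
        by (cases "value_iteration A B G M k z r") auto
    qed
    then show "\<exists>c. \<forall>k. \<bar>value_iteration A B G M k z r\<bar> \<le> ereal c" by blast
  qed
  then show "value_iteration_converges A B G M"
    using converges_iff_bounded[OF M] by blast
next
  assume "value_iteration_converges A B G M"
  then obtain V where V: "value_iteration_limit A B G M V"
    by (auto simp: value_iteration_converges_def)
  obtain \<eta> where \<eta>: "minimizing_law A B G M V \<eta>"
    using exists_minimizing_law[OF M V] by blast
  have "\<bar>V z (info_zero M)\<bar> \<noteq> \<infinity>" for z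
  proof -
    have "info_zero M \<in> infos M" "V_init M z (info_zero M) < \<infinity>"
      by (simp_all add: info_zero_def infos_def V_init_info_zero[OF M, unfolded info_zero_def])
    then show ?thesis
      using V by (simp add: value_iteration_limit_def finite_valued_def)
  qed
  then show "\<forall>z0. \<bar>problem_value A B G M z0\<bar> \<noteq> \<infinity>"
    by (simp add: minimizing_law_worst_case_cost(2)[OF M V \<eta>])
qed

section \<open>Fixed points are not unique\<close>

text \<open>The counterexample has a single model whose form is \<open>\<bar>u\<bar>\<^sup>2 - \<bar>d\<bar>\<^sup>2\<close>. Both players do best by playing
  \<open>0\<close>, the state never matters, and the value iteration is constant.\<close>

definition energy_matrix :: "('z::finite, 'u::finite, 'd::finite) hmat" where
  "energy_matrix = (\<chi> i j. if i = j
     then (case i of Inl (Inl _) \<Rightarrow> 0 | Inl (Inr _) \<Rightarrow> 1 | Inr _ \<Rightarrow> -1) else 0)"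

lemma energy_matrix_blocks:
  "block ix_z ix_z energy_matrix = 0" "block ix_u ix_u energy_matrix = mat 1"
  "block ix_d ix_d energy_matrix = - mat 1"
  "block ix_z ix_u energy_matrix = 0" "block ix_u ix_z energy_matrix = 0"
  "block Inl ix_d energy_matrix = 0" "block ix_d Inl energy_matrix = 0"
  "block ix_z ix_d energy_matrix = 0" "block ix_d ix_z energy_matrix = 0"
  "block ix_u ix_d energy_matrix = 0" "block ix_d ix_u energy_matrix = 0"
  by (auto simp: block_def energy_matrix_def mat_def vec_eq_iff)

lemma sigma_energy_matrix: "sigma energy_matrix z u d = u \<bullet> u - d \<bullet> d"
  by (simp add: sigma_def energy_matrix_blocks uminus_matrix_vector_mult)

lemma model_set_energy_matrix: "model_set {energy_matrix}"
proof -
  let ?H = "energy_matrix :: ('a, 'b, 'c) hmat"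
  let ?S = "block Inl Inl ?H"
  have schur: "schur_d ?H = ?S"
    by (simp add: schur_d_def energy_matrix_blocks)
  have blk: "block Inr Inr ?S = mat 1"
    by (auto simp: block_def energy_matrix_def mat_def vec_eq_iff)
  have "transpose ?H = ?H" "transpose ?S = ?S"
    by (auto simp: transpose_def block_def energy_matrix_def vec_eq_iff)
  moreover have "x \<bullet> (?S *v x) \<ge> 0" for x
  proof -
    have x: "x = stack (\<chi> a. x $ Inl a) (\<chi> b. x $ Inr b)"
      by (simp add: vec_eq_iff stack_def split: sum.split)
    have "block Inl Inl ?S = 0" "block Inl Inr ?S = 0" "block Inr Inl ?S = 0"
      by (auto simp: block_def energy_matrix_def vec_eq_iff)
    then show ?thesis
      by (subst (1 2) x) (simp add: quadratic_form_stack blk)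
  qed
  ultimately show ?thesis
    by (auto simp: model_set_def schur blk energy_matrix_blocks negdef_def posdef_def
        possemidef_def transpose_mat)
qed

lemma fixed_points_energy_matrix:
  fixes c :: real
  shows "bellman A B G {energy_matrix} (\<lambda>z r. ereal (r energy_matrix + c)) z r
    = ereal (r energy_matrix + c)"
proof -
  let ?V = "\<lambda>z r. ereal (r energy_matrix + c)"
  have bu: "bellman_u A B G {energy_matrix} u ?V z r = ereal (r energy_matrix + u \<bullet> u + c)" for u
    unfolding bellman_u_def
  proof (rule antisym)
    show "(SUP d. ereal (info_step {energy_matrix} r z u d energy_matrix + c))
        \<le> ereal (r energy_matrix + u \<bullet> u + c)"
      by (rule SUP_least) (simp add: info_step_def sigma_energy_matrix)
    show "ereal (r energy_matrix + u \<bullet> u + c)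
        \<le> (SUP d. ereal (info_step {energy_matrix} r z u d energy_matrix + c))"
      by (rule SUP_upper2[of 0]) (simp_all add: info_step_def sigma_energy_matrix)
  qed
  show ?thesis
    unfolding bellman_def bu
  proof (rule antisym)
    show "(INF u. ereal (r energy_matrix + u \<bullet> u + c)) \<le> ereal (r energy_matrix + c)"
      by (rule INF_lower2[of 0]) simp_all
    show "ereal (r energy_matrix + c) \<le> (INF u::real^_. ereal (r energy_matrix + u \<bullet> u + c))"
      by (rule INF_greatest) simp
  qed
qed

lemma nonunique_fixed_points:
  "\<exists>(A :: real^'z^'z) (B :: real^'u^'z) (G :: real^'d^'z) (M :: ('z, 'u, 'd) hmat set) Vs V.
     model_set M \<and> value_iteration_limit A B G M Vs \<and> fixed_point A B G M V
     \<and> finite_valued M V \<and> (\<exists>z. \<exists>r\<in>infos M. V_init M z r < \<infinity> \<and> V z r \<noteq> Vs z r)"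
proof -
  let ?H = "energy_matrix :: ('z, 'u, 'd) hmat"
  let ?V = "\<lambda>c (z::real^'z) (r::('z, 'u, 'd) info). ereal (r ?H + c)"
  have "value_iteration 0 0 0 {?H} k = ?V 0" for k
  proof (induction k)
    case 0
    show ?case by (intro ext) (simp add: V_init_def)
  next
    case (Suc k)
    show ?case
      unfolding value_iteration.simps(2) Suc
      by (intro ext fixed_points_energy_matrix)
  qed
  then have "value_iteration_limit 0 0 0 {?H} (?V 0)"
    by (simp add: value_iteration_limit_def finite_valued_def)
  moreover have "fixed_point 0 0 0 {?H} (?V 1)"
    by (simp only: fixed_point_def fixed_points_energy_matrix)  simp
  moreover have "finite_valued {?H} (?V 1)"
    by (simp add: finite_valued_def)
  moreover have "\<exists>z. \<exists>r\<in>infos {?H}. V_init {?H} z r < \<infinity> \<and> ?V 1 z r \<noteq> ?V 0 z r"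
    by (intro exI[of _ 0] bexI[of _ "info_zero {?H}"])
      (simp_all add: V_init_def info_zero_def infos_def)
  ultimately show ?thesis
    using model_set_energy_matrix by blast
qed

theorem theorem1:
  fixes A :: "real^'z^'z" and B :: "real^'u^'z" and G :: "real^'d^'z"
    and M :: "('z, 'u, 'd) hmat set"
  assumes M: "model_set M"
  shows
    "(\<forall>V V'. val_le M V V' \<longrightarrow> val_le M (bellman A B G M V) (bellman A B G M V'))
   \<and> (\<forall>k. val_le M (value_iteration A B G M k) (value_iteration A B G M (Suc k)))
   \<and> (value_iteration_converges A B G M \<longleftrightarrow> value_iteration_bounded A B G M)
   \<and> ((\<forall>z0. \<bar>problem_value A B G M z0\<bar> \<noteq> \<infinity>) \<longleftrightarrow> value_iteration_converges A B G M)
   \<and> (\<forall>Vs. value_iteration_limit A B G M Vs \<longrightarrow>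
        (\<forall>z0. problem_value A B G M z0 = Vs z0 (info_zero M))
      \<and> fixed_point A B G M Vs
      \<and> (val_le M (V_init M) Vs
         \<and> (\<forall>V. fixed_point A B G M V \<and> val_le M (V_init M) V \<longrightarrow> val_le M Vs V))
      \<and> (\<exists>\<eta>. minimizing_law A B G M Vs \<eta>)
      \<and> (\<forall>\<eta>. minimizing_law A B G M Vs \<eta> \<longrightarrow>
            (\<forall>z. \<forall>r\<in>infos M. bellman_u A B G M (\<eta> z r) Vs z r = bellman A B G M Vs z r)
          \<and> (\<forall>z0. optimal_policy A B G M z0 (info_policy M \<eta>))))
   \<and> (\<exists>(A' :: real^'z^'z) (B' :: real^'u^'z) (G' :: real^'d^'z) (M' :: ('z, 'u, 'd) hmat set) Vs V.
        model_set M' \<and> value_iteration_limit A' B' G' M' Vs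
      \<and> fixed_point A' B' G' M' V \<and> finite_valued M' V
      \<and> (\<exists>z. \<exists>r\<in>infos M'. V_init M' z r < \<infinity> \<and> V z r \<noteq> Vs z r))"
proof (intro conjI)
  show "\<forall>V V'. val_le M V V' \<longrightarrow> val_le M (bellman A B G M V) (bellman A B G M V')"
    by (blast intro: bellman_mono)
  show "\<forall>k. val_le M (value_iteration A B G M k) (value_iteration A B G M (Suc k))"
    using value_iteration_mono_Suc[OF M] by blast
  show "value_iteration_converges A B G M \<longleftrightarrow> value_iteration_bounded A B G M"
    by (rule converges_iff_bounded[OF M])
  show "(\<forall>z0. \<bar>problem_value A B G M z0\<bar> \<noteq> \<infinity>) \<longleftrightarrow> value_iteration_converges A B G M"
    by (rule finite_value_iff_converges[OF M])
  show "\<forall>Vs. value_iteration_limit A B G M Vs \<longrightarrow>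
        (\<forall>z0. problem_value A B G M z0 = Vs z0 (info_zero M))
      \<and> fixed_point A B G M Vs
      \<and> (val_le M (V_init M) Vs
         \<and> (\<forall>V. fixed_point A B G M V \<and> val_le M (V_init M) V \<longrightarrow> val_le M Vs V))
      \<and> (\<exists>\<eta>. minimizing_law A B G M Vs \<eta>)
      \<and> (\<forall>\<eta>. minimizing_law A B G M Vs \<eta> \<longrightarrow>
            (\<forall>z. \<forall>r\<in>infos M. bellman_u A B G M (\<eta> z r) Vs z r = bellman A B G M Vs z r)
          \<and> (\<forall>z0. optimal_policy A B G M z0 (info_policy M \<eta>)))"
  proof (intro allI impI)
    fix Vs assume Vs: "value_iteration_limit A B G M Vs"
    obtain \<eta> where \<eta>: "minimizing_law A B G M Vs \<eta>"
      using exists_minimizing_law[OF M Vs] by blast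
    have "\<forall>z0. problem_value A B G M z0 = Vs z0 (info_zero M)"
      using minimizing_law_worst_case_cost(2)[OF M Vs \<eta>] by blast
    moreover have "fixed_point A B G M Vs"
      using limit_fixed_point_minimizer(1)[OF M Vs] by (simp add: fixed_point_def)
    moreover have "val_le M (V_init M) Vs"
      using value_iteration_le_limit[OF M Vs, of 0] by simp
    moreover have "\<forall>V. fixed_point A B G M V \<and> val_le M (V_init M) V \<longrightarrow> val_le M Vs V"
      using limit_least_fixed_point[OF M Vs] by blast
    moreover have "optimal_policy A B G M z0 (info_policy M \<eta>)"
      if "minimizing_law A B G M Vs \<eta>" for \<eta> z0
      using minimizing_law_worst_case_cost[OF M Vs that] by (simp add: optimal_policy_def)
    moreover have "\<forall>z. \<forall>r\<in>infos M. bellman_u A B G M (\<eta> z r) Vs z r = bellman A B G M Vs z r"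
      if "minimizing_law A B G M Vs \<eta>" for \<eta>
      using that by (simp only: minimizing_law_iff)
    ultimately show "(\<forall>z0. problem_value A B G M z0 = Vs z0 (info_zero M))
      \<and> fixed_point A B G M Vs
      \<and> (val_le M (V_init M) Vs
         \<and> (\<forall>V. fixed_point A B G M V \<and> val_le M (V_init M) V \<longrightarrow> val_le M Vs V))
      \<and> (\<exists>\<eta>. minimizing_law A B G M Vs \<eta>)
      \<and> (\<forall>\<eta>. minimizing_law A B G M Vs \<eta> \<longrightarrow>
            (\<forall>z. \<forall>r\<in>infos M. bellman_u A B G M (\<eta> z r) Vs z r = bellman A B G M Vs z r)
          \<and> (\<forall>z0. optimal_policy A B G M z0 (info_policy M \<eta>)))"
      using \<eta> by blast
  qed
  show "\<exists>(A' :: real^'z^'z) (B' :: real^'u^'z) (G' :: real^'d^'z) (M' :: ('z, 'u, 'd) hmat set) Vs V.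
        model_set M' \<and> value_iteration_limit A' B' G' M' Vs
      \<and> fixed_point A' B' G' M' V \<and> finite_valued M' V
      \<and> (\<exists>z. \<exists>r\<in>infos M'. V_init M' z r < \<infinity> \<and> V z r \<noteq> Vs z r)"
    by (rule nonunique_fixed_points)
qed

end
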